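(* Let $(X_1,\ldots,X_d)\in M_n(\mathbb{C})^d$. Then $$\frac{1}{\sqrt{d}}\,\hat{\rho}(X_1,\ldots,X_d)\le\rho(X_1,\ldots,X_d)\le\hat{\rho}(X_1,\ldots,X_d).$$
   Context: For a single square matrix, $\rho$ denotes the spectral radius. For a tuple, $\rho(X_1,\ldots,X_d)$ denotes the joint spectral radius $$\rho(X_1,\ldots,X_d)=\lim_{k\to\infty}\sup_{1\le i_1,\ldots,i_k\le d}\|X_{i_1}\cdots X_{i_k}\|^{1/k},$$ with $\|\cdot\|$ the operator norm. The outer spectral radius is $\hat{\rho}(X_1,\ldots,X_d)=\sqrt{\rho(\sum_{i=1}^d\overline{X_i}\otimes X_i)}$, where $\overline{A}$ is the entrywise complex conjugate and $\otimes$ is the Kronecker product. *)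

theory Defs
  imports "HOL-Analysis.L2_Norm" "Jordan_Normal_Form.Spectral_Radius"
begin

definition l2_norm_vec :: "complex vec \<Rightarrow> real" where
  "l2_norm_vec v = L2_set (\<lambda>i. cmod (v $ i)) {..<dim_vec v}"

(* The same shape as onorm in HOL-Analysis; the zero vector contributes 0 / 0 = 0. *)
definition op_norm_mat :: "complex mat \<Rightarrow> real" where
  "op_norm_mat A = (SUP v\<in>carrier_vec (dim_col A). l2_norm_vec (A *\<^sub>v v) / l2_norm_vec v)"

definition kronecker_mat :: "complex mat \<Rightarrow> complex mat \<Rightarrow> complex mat" (infixr "\<otimes>\<^sub>K" 70) where
  "A \<otimes>\<^sub>K B = mat (dim_row A * dim_row B) (dim_col A * dim_col B)
     (\<lambda>(i, j). A $$ (i div dim_row B, j div dim_col B) * B $$ (i mod dim_row B, j mod dim_col B))"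

text \<open>A \<open>d\<close>-tuple \<open>(X\<^sub>1, \<dots>, X\<^sub>d)\<close> of \<open>n \<times> n\<close> matrices is a function \<open>X\<close> on indices, of which
  only the values on \<open>{1..d}\<close> are used.\<close>

definition word_prod :: "nat \<Rightarrow> (nat \<Rightarrow> complex mat) \<Rightarrow> nat list \<Rightarrow> complex mat" where
  "word_prod n X is = foldr (\<lambda>i M. X i * M) is (1\<^sub>m n)"

(* The term for k = 0 is 0 since root 0 x = 0; it is irrelevant to the limit. *)
definition joint_spectral_radius :: "nat \<Rightarrow> nat \<Rightarrow> (nat \<Rightarrow> complex mat) \<Rightarrow> real" where
  "joint_spectral_radius n d X =
     lim (\<lambda>k. SUP is\<in>{is. length is = k \<and> set is \<subseteq> {1..d}}. root k (op_norm_mat (word_prod n X is)))"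

definition outer_spectral_radius :: "nat \<Rightarrow> nat \<Rightarrow> (nat \<Rightarrow> complex mat) \<Rightarrow> real" where
  "outer_spectral_radius n d X =
     sqrt (spectral_radius
       (\<Oplus>\<^bsub>module_mat TYPE(complex) (n * n) (n * n)\<^esub>i\<in>{1..d}. map_mat cnj (X i) \<otimes>\<^sub>K X i))"

end

(* Write M for the matrix whose spectral radius defines the outer spectral radius. Then M^k is
   the sum of cnj W \<otimes> W over the products W of words of length k. The triangle inequality
   bounds its entries by d^k times the square of the largest norm of such a product, while some of
   its entries are sums of squares of absolute values of entries of the products W and hence
   dominate each of them. Taking 2k-th roots, with Fekete's argument for the existence of the joint
   spectral radius, gives both inequalities. *)
theory Submission
  imports Defs
begin

section \<open>Roots of submultiplicative sequences\<close>

text \<open>Fekete's argument: the limit is the infimum \<open>L\<close> of the roots over k \<ge>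
  1. If some m has \<open>root m (a m) < c\<close>, splitting off blocks of length m gives
  \<open>a k \<le> B * c ^ k\<close> for all k, and the constant vanishes under the k-th
  root.\<close>

lemma submultiplicative_root_convergent:
  fixes a :: "nat \<Rightarrow> real"
  assumes nonneg: "\<And>k. 0 \<le> a k" and submult: "\<And>j k. a (j + k) \<le> a j * a k"
  shows "convergent (\<lambda>k. root k (a k))"
proof -
  define L where "L = (INF k\<in>{1..}. root k (a k))"
  have bdd: "bdd_below ((\<lambda>k. root k (a k)) ` {1..})"
    by (rule bdd_belowI2[of _ 0]) (simp add: nonneg)
  have L_le: "L \<le> root k (a k)" if "k \<ge> 1" for k
    unfolding L_def using that bdd by (intro cINF_lower) auto
  have L_nonneg: "0 \<le> L"
    unfolding L_def by (rule cINF_greatest) (auto simp: nonneg)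
  have "(\<lambda>k. root k (a k)) \<longlonglongrightarrow> L"
  proof (rule order_tendstoI)
    fix x assume "x < L"
    then show "\<forall>\<^sub>F k in sequentially. x < root k (a k)"
      using L_le by (intro eventually_sequentiallyI[of 1]) force
  next
    fix x assume "L < x"
    \<comment> \<open>The gap between \<open>c\<close> and \<open>x\<close> absorbs the factor
      \<open>root k B\<close>, which is close to 1 but may exceed it.\<close>
    then obtain c where c: "L < c" "c < x" using dense by blast
    then have c0: "c > 0" using L_nonneg by simp
    have "\<exists>m\<in>{1..}. root m (a m) < c"
      using c(1) bdd unfolding L_def by (subst (asm) cINF_less_iff) auto
    then obtain m where m: "m \<ge> 1" "root m (a m) < c" by auto
    have am: "a m \<le> c ^ m"
      using m nonneg[of m] power_mono[of "root m (a m)" c m] by (simp add: real_root_pow_pos2)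
    \<comment> \<open>The sum handles every remainder j < m left after splitting off blocks; the
      summand 1 makes \<open>B\<close> positive, so that its k-th root tends to 1.\<close>
    define B where "B = 1 + (\<Sum>j<m. a j / c ^ j)"
    have B1: "B > 0" unfolding B_def using c0 nonneg
      by (intro add_pos_nonneg sum_nonneg) auto
    have bound: "a k \<le> B * c ^ k" for k
    proof (induction k rule: less_induct)
      case (less k)
      show ?case
      proof (cases "k < m")
        case True
        then have "a k / c ^ k \<le> (\<Sum>j<m. a j / c ^ j)"
          using c0 nonneg by (intro member_le_sum) auto
        then have "a k / c ^ k \<le> B" by (simp add: B_def)
        then show ?thesis using c0 by (simp add: field_simps)
      next
        case False
        then have "a k \<le> a m * a (k - m)" using submult[of m "k - m"] by simp
        also have "\<dots> \<le> c ^ m * (B * c ^ (k - m))"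
          using False m c0 am nonneg less by (intro mult_mono) auto
        also have "\<dots> = B * c ^ k" using False by (simp flip: power_add)
        finally show ?thesis .
      qed
    qed
    have "(\<lambda>k. root k B * c) \<longlonglongrightarrow> 1 * c"
      by (intro tendsto_intros LIMSEQ_root_const B1)
    then have "\<forall>\<^sub>F k in sequentially. root k B * c < x"
      using c(2) by (auto dest: order_tendstoD(2))
    then show "\<forall>\<^sub>F k in sequentially. root k (a k) < x"
      using eventually_ge_at_top[of 1]
    proof eventually_elim
      case (elim k)
      have "root k (a k) \<le> root k (B * c ^ k)" using bound elim by simp
      also have "\<dots> = root k B * c" using elim c0 by (simp add: real_root_mult real_root_power_cancel)
      finally show ?case using elim by simp
    qed
  qed
  then show ?thesis by (rule convergentI)
qed

lemma root_limit_le: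
  fixes a :: "nat \<Rightarrow> real"
  assumes lim: "(\<lambda>k. root k (a k)) \<longlonglongrightarrow> L" and "c \<ge> 0" and bound: "\<And>k. a k \<le> B * c ^ k"
  shows "L \<le> c"
proof -
  \<comment> \<open>\<open>B\<close> may be zero or negative, whereas k-th roots tend to 1 only for
    a positive constant.\<close>
  define C where "C = max B 1"
  have "(\<lambda>k. root k C * c) \<longlonglongrightarrow> 1 * c"
    by (intro tendsto_intros LIMSEQ_root_const) (simp add: C_def)
  moreover have "\<forall>\<^sub>F k in sequentially. root k (a k) \<le> root k C * c"
  proof (rule eventually_sequentiallyI[of 1])
    fix k :: nat assume k: "k \<ge> 1"
    have "a k \<le> C * c ^ k"
      using bound[of k] \<open>c \<ge> 0\<close> by (rule_tac order_trans) (auto simp: C_def intro!: mult_right_mono)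
    then have "root k (a k) \<le> root k (C * c ^ k)" using k by simp
    also have "\<dots> = root k C * c"
      using k \<open>c \<ge> 0\<close> by (simp add: real_root_mult real_root_power_cancel)
    finally show "root k (a k) \<le> root k C * c" .
  qed
  ultimately show ?thesis using lim
    by (auto intro: tendsto_le[OF sequentially_bot])
qed

lemma root_limit_ge:
  fixes a :: "nat \<Rightarrow> real"
  assumes lim: "(\<lambda>k. root k (a k)) \<longlonglongrightarrow> L" and "c \<ge> 0" and "B > 0"
    and bound: "\<And>k. c ^ k \<le> B * a k"
  shows "c \<le> L"
proof -
  have "(\<lambda>k. root k B * root k (a k)) \<longlonglongrightarrow> 1 * L"
    by (intro tendsto_intros LIMSEQ_root_const lim \<open>B > 0\<close>)
  moreover have "\<forall>\<^sub>F k in sequentially. c \<le> root k B * root k (a k)"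
  proof (rule eventually_sequentiallyI[of 1])
    fix k :: nat assume k: "k \<ge> 1"
    have "c = root k (c ^ k)" using k \<open>c \<ge> 0\<close> by (simp add: real_root_power_cancel)
    also have "\<dots> \<le> root k (B * a k)" using k bound by simp
    finally show "c \<le> root k B * root k (a k)" by (simp add: real_root_mult)
  qed
  ultimately show ?thesis
    by (auto intro: tendsto_lowerbound)
qed

section \<open>Powers of a matrix and its spectral radius\<close>

text \<open>The recursion of \<open>pow_mat\<close> appends the new factor on the right, but words
  grow at their head; this form fits the induction over words.\<close>

lemma pow_mat_Suc_left:
  fixes A :: "'a :: semiring_1 mat"
  assumes A: "A \<in> carrier_mat n n"
  shows "A ^\<^sub>m Suc k = A * A ^\<^sub>m k"
proof (induction k)
  case 0
  then show ?case using A by simp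
next
  case (Suc k)
  have "A ^\<^sub>m Suc (Suc k) = (A * A ^\<^sub>m k) * A" using Suc by simp
  also have "\<dots> = A * A ^\<^sub>m Suc k"
    using A by (simp add: assoc_mult_mat[of _ n n _ n _ n])
  finally show ?case .
qed

lemma pow_mat_smult:
  fixes A :: "'a :: comm_semiring_1 mat"
  assumes A: "A \<in> carrier_mat n n"
  shows "(c \<cdot>\<^sub>m A) ^\<^sub>m k = c ^ k \<cdot>\<^sub>m A ^\<^sub>m k"
proof (induction k)
  case 0
  show ?case using A by (intro eq_matI) auto
next
  case (Suc k)
  have "(c \<cdot>\<^sub>m A) ^\<^sub>m Suc k = (c ^ k \<cdot>\<^sub>m A ^\<^sub>m k) * (c \<cdot>\<^sub>m A)" using Suc by simp
  also have "\<dots> = c ^ Suc k \<cdot>\<^sub>m A ^\<^sub>m Suc k"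
    using A pow_carrier_mat[OF A, of k]
    by (intro eq_matI) (auto simp: scalar_prod_def sum_distrib_left ac_simps)
  finally show ?case .
qed

lemma eigenvalue_smult:
  fixes A :: "complex mat"
  assumes A: "A \<in> carrier_mat n n" and "c \<noteq> 0" and ev: "eigenvalue (c \<cdot>\<^sub>m A) e"
  shows "eigenvalue A (e / c)"
proof -
  obtain v where v: "v \<in> carrier_vec n" "v \<noteq> 0\<^sub>v n" "(c \<cdot>\<^sub>m A) *\<^sub>v v = e \<cdot>\<^sub>v v"
    using ev A unfolding eigenvalue_def eigenvector_def by auto
  have "A *\<^sub>v v = (e / c) \<cdot>\<^sub>v v"
  proof (rule eq_vecI)
    fix i assume i: "i < dim_vec ((e / c) \<cdot>\<^sub>v v)"
    have "c * (A *\<^sub>v v) $ i = ((c \<cdot>\<^sub>m A) *\<^sub>v v) $ i"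
      using i A v(1) by (simp add: scalar_prod_def sum_distrib_left mult.assoc)
    also have "\<dots> = e * v $ i" using i v by simp
    finally show "(A *\<^sub>v v) $ i = ((e / c) \<cdot>\<^sub>v v) $ i"
      using i \<open>c \<noteq> 0\<close> by (simp add: field_simps)
  qed (use A v in auto)
  then show ?thesis using v A unfolding eigenvalue_def eigenvector_def by auto
qed

text \<open>Scaling by 1 / r brings the spectral radius below 1, where the powers are bounded by way
  of the Jordan normal form. Undoing the scaling gives the factor \<open>r ^ k\<close>. The strict
  inequality leaves room for polynomial growth from Jordan blocks.\<close>

lemma pow_mat_norm_bound:
  assumes A: "A \<in> carrier_mat n n" and n: "n > 0" and r: "spectral_radius A < r" and "r > 0"
  shows "\<exists>C. \<forall>k. norm_bound (A ^\<^sub>m k) (C * r ^ k)"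
proof -
  define c where "c = complex_of_real (1 / r)"
  have c0: "c \<noteq> 0" using \<open>r > 0\<close> by (simp add: c_def)
  have cA: "c \<cdot>\<^sub>m A \<in> carrier_mat n n" using A by simp
  obtain e where e: "e \<in> spectrum (c \<cdot>\<^sub>m A)" "cmod e = spectral_radius (c \<cdot>\<^sub>m A)"
    using spectral_radius_mem_max(1)[OF cA n] by force
  \<comment> \<open>An eigenvalue of largest modulus of the scaled matrix is traced back to one of
    \<open>A\<close>, so its modulus is at most \<open>spectral_radius A / r\<close>.\<close>
  have "e / c \<in> spectrum A"
    using eigenvalue_smult[OF A c0] e by (auto simp: spectrum_def)
  then have "cmod (e / c) \<le> spectral_radius A"
    using spectral_radius_mem_max(2)[OF A n] by blast
  then have "cmod e * r \<le> spectral_radius A"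
    using \<open>r > 0\<close> by (simp add: c_def norm_divide norm_mult)
  then have "cmod e * r < 1 * r" using r by linarith
  then have "spectral_radius (c \<cdot>\<^sub>m A) < 1"
    unfolding e(2) using \<open>r > 0\<close> by (rule mult_right_less_imp_less[OF _ less_imp_le])
  then obtain C where C: "\<And>k. norm_bound ((c \<cdot>\<^sub>m A) ^\<^sub>m k) C"
    using spectral_radius_jnf_norm_bound_less_1_upper_triangular[OF cA] by blast
  have "norm_bound (A ^\<^sub>m k) (C * r ^ k)" for k
  proof (rule norm_boundI)
    fix i j assume "i < dim_row (A ^\<^sub>m k)" "j < dim_col (A ^\<^sub>m k)"
    then have "cmod (c ^ k * (A ^\<^sub>m k) $$ (i, j)) \<le> C"
      using C[of k] A unfolding norm_bound_def pow_mat_smult[OF A] by simp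
    then show "cmod ((A ^\<^sub>m k) $$ (i, j)) \<le> C * r ^ k"
      using \<open>r > 0\<close> by (simp add: c_def norm_mult norm_power norm_divide field_simps)
  qed
  then show ?thesis by blast
qed

lemma norm_mult_mat_vec_index_le:
  fixes A :: "complex mat"
  assumes A: "A \<in> carrier_mat n m" and v: "v \<in> carrier_vec m" and "i < n"
    and bound: "norm_bound A b" and x: "\<And>j. j < m \<Longrightarrow> cmod (v $ j) \<le> x"
  shows "cmod ((A *\<^sub>v v) $ i) \<le> real m * b * x"
proof -
  have "cmod ((A *\<^sub>v v) $ i) = cmod (\<Sum>j<m. A $$ (i, j) * v $ j)"
    using A v \<open>i < n\<close> by (simp add: scalar_prod_def atLeast0LessThan)
  also have "\<dots> \<le> (\<Sum>j<m. cmod (A $$ (i, j) * v $ j))" by (rule norm_sum)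
  also have "\<dots> \<le> (\<Sum>j<m. b * x)"
  proof (rule sum_mono)
    fix j assume "j \<in> {..<m}"
    then have "cmod (A $$ (i, j)) \<le> b" "cmod (v $ j) \<le> x"
      using bound A x \<open>i < n\<close> unfolding norm_bound_def by auto
    then show "cmod (A $$ (i, j) * v $ j) \<le> b * x"
      unfolding norm_mult by (intro mult_mono) (auto intro: order_trans[OF norm_ge_zero])
  qed
  finally show ?thesis by simp
qed

text \<open>Take an eigenvector v for an eigenvalue e of maximal modulus and read
  \<open>A ^\<^sub>m k *\<^sub>v v\<close> = e^k v at a coordinate where v is largest in modulus;
  that modulus then cancels.\<close>

lemma spectral_radius_power_le:
  assumes A: "A \<in> carrier_mat n n" and n: "n > 0" and bound: "norm_bound (A ^\<^sub>m k) b"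
  shows "spectral_radius A ^ k \<le> real n * b"
proof -
  obtain e where "e \<in> spectrum A" and e: "cmod e = spectral_radius A"
    using spectral_radius_mem_max(1)[OF A n] by force
  then obtain v where ev: "eigenvector A v e" by (auto simp: spectrum_def eigenvalue_def)
  then have v: "v \<in> carrier_vec n" "v \<noteq> 0\<^sub>v n" using A by (auto simp: eigenvector_def)
  define x where "x = Max ((\<lambda>j. cmod (v $ j)) ` {..<n})"
  have fin: "finite ((\<lambda>j. cmod (v $ j)) ` {..<n})" "(\<lambda>j. cmod (v $ j)) ` {..<n} \<noteq> {}"
    using n by auto
  obtain i where i: "i < n" "cmod (v $ i) = x"
    using Max_in[OF fin] unfolding x_def by force
  have le: "cmod (v $ j) \<le> x" if "j < n" for j
    unfolding x_def using that by (intro Max_ge) auto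
  obtain j where "j < n" "v $ j \<noteq> 0" using v by force
  then have "x > 0" using le[of j] by (meson norm_ge_zero zero_less_norm_iff less_le_trans)
  have "spectral_radius A ^ k * x = cmod ((A ^\<^sub>m k *\<^sub>v v) $ i)"
    using eigenvector_pow[OF A ev, of k] v i e by (simp add: norm_mult norm_power)
  also have "\<dots> \<le> real n * b * x"
    using norm_mult_mat_vec_index_le[OF pow_carrier_mat[OF A] v(1) i(1) bound] le by blast
  finally show ?thesis using \<open>x > 0\<close> by simp
qed

section \<open>The operator norm\<close>

lemma l2_norm_vec_nonneg [simp]: "0 \<le> l2_norm_vec v"
  by (simp add: l2_norm_vec_def)

lemma norm_index_le_l2_norm_vec: "i < dim_vec v \<Longrightarrow> cmod (v $ i) \<le> l2_norm_vec v"
  unfolding l2_norm_vec_def by (rule member_le_L2_set) auto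

lemma l2_norm_vec_eq_0: "l2_norm_vec v = 0 \<longleftrightarrow> v = 0\<^sub>v (dim_vec v)"
  unfolding l2_norm_vec_def by (auto simp: L2_set_eq_0_iff vec_eq_iff)

lemma l2_norm_unit_vec: "j < n \<Longrightarrow> l2_norm_vec (unit_vec n j) = 1"
  unfolding l2_norm_vec_def L2_set_def by (simp add: if_distrib[where f = "\<lambda>x. cmod x ^ 2"] cong: if_cong)

text \<open>The Euclidean norm is at most the sum of the moduli. The dimension factors are crude,
  but they disappear when k-th roots are taken.\<close>

lemma l2_norm_mult_mat_vec_le_norm_bound:
  assumes A: "A \<in> carrier_mat n m" and v: "v \<in> carrier_vec m" and bound: "norm_bound A b"
  shows "l2_norm_vec (A *\<^sub>v v) \<le> real n * real m * b * l2_norm_vec v"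
proof -
  have "l2_norm_vec (A *\<^sub>v v) \<le> (\<Sum>i<n. cmod ((A *\<^sub>v v) $ i))"
    unfolding l2_norm_vec_def using A by (auto intro: order_trans[OF L2_set_le_sum])
  also have "\<dots> \<le> (\<Sum>i<n. real m * b * l2_norm_vec v)"
    using v by (intro sum_mono norm_mult_mat_vec_index_le[OF A v _ bound])
      (auto intro: norm_index_le_l2_norm_vec)
  finally show ?thesis by simp
qed

lemma norm_bound_nonneg:
  assumes "A \<in> carrier_mat n m" "n > 0" "m > 0" "norm_bound A b"
  shows "0 \<le> b"
  using assms unfolding norm_bound_def by (metis carrier_matD norm_ge_zero order_trans)

text \<open>Together with \<open>op_norm_quotient_le\<close> this bounds the quotients in
  \<open>op_norm_mat\<close> from above, so that their supremum really is an upper bound.\<close>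

lemma norm_bound_exists:
  fixes A :: "complex mat"
  shows "\<exists>b\<ge>0. norm_bound A b"
proof -
  let ?b = "\<Sum>i<dim_row A. \<Sum>j<dim_col A. cmod (A $$ (i, j))"
  have "norm_bound A ?b"
  proof (rule norm_boundI)
    fix i j assume ij: "i < dim_row A" "j < dim_col A"
    have "cmod (A $$ (i, j)) \<le> (\<Sum>j<dim_col A. cmod (A $$ (i, j)))"
      using ij by (intro member_le_sum) auto
    also have "\<dots> \<le> ?b"
      using ij by (intro member_le_sum[of i _ "\<lambda>i. \<Sum>j<dim_col A. cmod (A $$ (i, j))"])
        (auto intro: sum_nonneg)
    finally show "cmod (A $$ (i, j)) \<le> ?b" .
  qed
  moreover have "0 \<le> ?b" by (intro sum_nonneg) simp
  ultimately show ?thesis by blast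
qed

lemma op_norm_quotient_le:
  assumes A: "A \<in> carrier_mat n m" and v: "v \<in> carrier_vec m" and "0 \<le> b" "norm_bound A b"
  shows "l2_norm_vec (A *\<^sub>v v) / l2_norm_vec v \<le> real n * real m * b"
proof (cases "l2_norm_vec v = 0")
  case False
  then have "l2_norm_vec v > 0" using l2_norm_vec_nonneg[of v] by linarith
  then show ?thesis
    using l2_norm_mult_mat_vec_le_norm_bound[OF A v assms(4)] by (simp add: divide_le_eq)
qed (use assms in simp)

lemma op_norm_mat_le:
  assumes "A \<in> carrier_mat n m" "0 \<le> b" "norm_bound A b"
  shows "op_norm_mat A \<le> real n * real m * b"
  unfolding op_norm_mat_def
proof (rule cSUP_least)
  show "(carrier_vec (dim_col A) :: complex vec set) \<noteq> {}" by (metis zero_carrier_vec empty_iff)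
qed (use assms in \<open>auto intro: op_norm_quotient_le\<close>)

lemma op_norm_quotient_le_op_norm:
  assumes v: "v \<in> carrier_vec (dim_col A)"
  shows "l2_norm_vec (A *\<^sub>v v) / l2_norm_vec v \<le> op_norm_mat A"
proof -
  obtain b where b: "b \<ge> 0" "norm_bound A b" using norm_bound_exists by blast
  have "A \<in> carrier_mat (dim_row A) (dim_col A)" by simp
  then show ?thesis unfolding op_norm_mat_def
    using op_norm_quotient_le b v
    by (intro cSUP_upper bdd_aboveI2[where M = "real (dim_row A) * real (dim_col A) * b"]) blast+
qed

lemma op_norm_mat_nonneg: "0 \<le> op_norm_mat A"
  by (rule order_trans[OF _ op_norm_quotient_le_op_norm[of "0\<^sub>v (dim_col A)"]]) auto

text \<open>The quotient bound is cleared of its denominator. The zero vector is treated apart,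
  since there the quotient is 0 / 0 = 0 and says nothing about the image.\<close>

lemma l2_norm_mult_mat_vec_le:
  assumes v: "v \<in> carrier_vec (dim_col A)"
  shows "l2_norm_vec (A *\<^sub>v v) \<le> op_norm_mat A * l2_norm_vec v"
proof (cases "l2_norm_vec v = 0")
  case True
  then have "v = 0\<^sub>v (dim_col A)" using v by (auto simp: l2_norm_vec_eq_0)
  then have "A *\<^sub>v v = 0\<^sub>v (dim_row A)" by (intro eq_vecI) auto
  then have "l2_norm_vec (A *\<^sub>v v) = 0" by (subst l2_norm_vec_eq_0) simp
  then show ?thesis using True by simp
next
  case False
  then have "l2_norm_vec v > 0" using l2_norm_vec_nonneg[of v] by linarith
  then show ?thesis
    using op_norm_quotient_le_op_norm[OF v] by (simp add: divide_le_eq)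
qed

lemma op_norm_mat_mult_le:
  assumes A: "A \<in> carrier_mat n m" and B: "B \<in> carrier_mat m l"
  shows "op_norm_mat (A * B) \<le> op_norm_mat A * op_norm_mat B"
  unfolding op_norm_mat_def[of "A * B"]
proof (rule cSUP_least)
  fix v :: "complex vec" assume "v \<in> carrier_vec (dim_col (A * B))"
  then have v: "v \<in> carrier_vec l" using B by simp
  have "l2_norm_vec ((A * B) *\<^sub>v v) = l2_norm_vec (A *\<^sub>v (B *\<^sub>v v))" using A B v by simp
  also have "\<dots> \<le> op_norm_mat A * l2_norm_vec (B *\<^sub>v v)"
    using A B v by (intro l2_norm_mult_mat_vec_le) auto
  also have "\<dots> \<le> op_norm_mat A * (op_norm_mat B * l2_norm_vec v)"
    using A B v by (intro mult_left_mono l2_norm_mult_mat_vec_le op_norm_mat_nonneg) auto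
  finally have le: "l2_norm_vec ((A * B) *\<^sub>v v) \<le> op_norm_mat A * op_norm_mat B * l2_norm_vec v"
    by (simp add: mult.assoc)
  show "l2_norm_vec ((A * B) *\<^sub>v v) / l2_norm_vec v \<le> op_norm_mat A * op_norm_mat B"
  proof (cases "l2_norm_vec v = 0")
    case False
    then have "l2_norm_vec v > 0" using l2_norm_vec_nonneg[of v] by linarith
    then show ?thesis using le by (simp add: divide_le_eq)
  qed (simp add: op_norm_mat_nonneg)
qed (metis zero_carrier_vec empty_iff)

text \<open>Entry (i, j) is coordinate i of the image of the j-th unit vector, which has norm
  1.\<close>

lemma norm_bound_op_norm_mat: "norm_bound A (op_norm_mat A)"
proof (rule norm_boundI)
  fix i j assume ij: "i < dim_row A" "j < dim_col A"
  have "cmod (A $$ (i, j)) = cmod ((A *\<^sub>v unit_vec (dim_col A) j) $ i)"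
    using ij by (simp add: scalar_prod_right_unit)
  also have "\<dots> \<le> l2_norm_vec (A *\<^sub>v unit_vec (dim_col A) j)"
    using ij by (intro norm_index_le_l2_norm_vec) simp
  also have "\<dots> \<le> op_norm_mat A"
    using l2_norm_mult_mat_vec_le[of "unit_vec (dim_col A) j" A] ij by (simp add: l2_norm_unit_vec)
  finally show "cmod (A $$ (i, j)) \<le> op_norm_mat A" .
qed

section \<open>Kronecker products and words\<close>

lemma kronecker_mat_carrier:
  assumes "A \<in> carrier_mat n m" "B \<in> carrier_mat n' m'"
  shows "A \<otimes>\<^sub>K B \<in> carrier_mat (n * n') (m * m')"
  using assms by (simp add: kronecker_mat_def)

lemma div_less_of_mult: "p < n * n \<Longrightarrow> p div n < n" for p n :: nat
  by (simp add: less_mult_imp_div_less)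

lemma mod_less_of_mult: "p < n * m \<Longrightarrow> p mod m < m" for p n :: nat
  by (cases "m = 0") auto

text \<open>Division with remainder by m is a bijection between the indices below n * m and the
  pairs (a, b); Kronecker products use this indexing.\<close>

lemma sum_div_mod:
  fixes f :: "nat \<Rightarrow> nat \<Rightarrow> 'a :: comm_monoid_add"
  shows "(\<Sum>c<n * m. f (c div m) (c mod m)) = (\<Sum>a<n. \<Sum>b<m. f a b)"
proof -
  have "(\<Sum>a<n. \<Sum>b<m. f a b) = (\<Sum>(a, b)\<in>{..<n} \<times> {..<m}. f a b)"
    by (rule sum.cartesian_product)
  also have "\<dots> = (\<Sum>c<n * m. f (c div m) (c mod m))"
  proof (rule sum.reindex_bij_witness[where i = "\<lambda>c. (c div m, c mod m)" and j = "\<lambda>(a, b). a * m + b"])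
    fix p assume "p \<in> {..<n} \<times> {..<m}"
    then obtain a b where p: "p = (a, b)" "a < n" "b < m" by auto
    have "a * m + b < Suc a * m" using p by simp
    also have "\<dots> \<le> n * m" using p by (intro mult_le_mono1) simp
    finally show "(case p of (a, b) \<Rightarrow> a * m + b) \<in> {..<n * m}" using p by simp
  qed (auto simp: less_mult_imp_div_less mod_less_of_mult)
  finally show ?thesis by simp
qed

text \<open>The mixed-product rule: the inner summation index splits into quotient and remainder,
  and the resulting double sum factors.\<close>

lemma kronecker_mat_mult:
  assumes A: "A \<in> carrier_mat n n" and B: "B \<in> carrier_mat m m"
    and C: "C \<in> carrier_mat n n" and D: "D \<in> carrier_mat m m"
  shows "(A \<otimes>\<^sub>K B) * (C \<otimes>\<^sub>K D) = (A * C) \<otimes>\<^sub>K (B * D)"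
proof (rule eq_matI)
  fix p q assume "p < dim_row ((A * C) \<otimes>\<^sub>K (B * D))" "q < dim_col ((A * C) \<otimes>\<^sub>K (B * D))"
  then have pq: "p < n * m" "q < n * m" using A B C D by (auto simp: kronecker_mat_def)
  have lt: "p div m < n" "q div m < n" "p mod m < m" "q mod m < m"
    using pq by (auto simp: less_mult_imp_div_less mod_less_of_mult)
  have "((A \<otimes>\<^sub>K B) * (C \<otimes>\<^sub>K D)) $$ (p, q) =
      (\<Sum>c<n * m. (A $$ (p div m, c div m) * B $$ (p mod m, c mod m))
        * (C $$ (c div m, q div m) * D $$ (c mod m, q mod m)))"
    using A B C D pq by (simp add: kronecker_mat_def scalar_prod_def atLeast0LessThan)
  also have "\<dots> = (\<Sum>a<n. \<Sum>b<m. (A $$ (p div m, a) * B $$ (p mod m, b))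
        * (C $$ (a, q div m) * D $$ (b, q mod m)))"
    by (rule sum_div_mod)
  also have "\<dots> = (\<Sum>a<n. A $$ (p div m, a) * C $$ (a, q div m))
        * (\<Sum>b<m. B $$ (p mod m, b) * D $$ (b, q mod m))"
    by (simp add: sum_product ac_simps)
  also have "\<dots> = ((A * C) \<otimes>\<^sub>K (B * D)) $$ (p, q)"
    using A B C D pq lt by (simp add: kronecker_mat_def scalar_prod_def atLeast0LessThan)
  finally show "((A \<otimes>\<^sub>K B) * (C \<otimes>\<^sub>K D)) $$ (p, q) = ((A * C) \<otimes>\<^sub>K (B * D)) $$ (p, q)" .
qed (use assms in \<open>auto simp: kronecker_mat_def\<close>)

lemma map_mat_cnj_mult:
  assumes "A \<in> carrier_mat n m" "B \<in> carrier_mat m l"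
  shows "map_mat cnj (A * B) = map_mat cnj A * map_mat cnj B"
  using assms by (intro eq_matI) (auto simp: scalar_prod_def)

lemma map_mat_cnj_kronecker_mult:
  assumes A: "A \<in> carrier_mat n n" and B: "B \<in> carrier_mat n n"
  shows "map_mat cnj (A * B) \<otimes>\<^sub>K (A * B) = (map_mat cnj A \<otimes>\<^sub>K A) * (map_mat cnj B \<otimes>\<^sub>K B)"
  using A B by (simp add: map_mat_cnj_mult kronecker_mat_mult)

text \<open>Turns the abstract sum in the module of matrices into entrywise sums, on which all later
  computations rest.\<close>

lemma finsum_module_mat:
  assumes "finite I" "\<And>i. i \<in> I \<Longrightarrow> f i \<in> carrier_mat r c"
  shows "(\<Oplus>\<^bsub>module_mat TYPE('a :: comm_ring_1) r c\<^esub>i\<in>I. f i) =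
    mat r c (\<lambda>(p, q). \<Sum>i\<in>I. f i $$ (p, q))"
proof -
  interpret abelian_group "module_mat TYPE('a) r c" by (rule abelian_group_mat)
  show ?thesis using assms
  proof (induction I)
    case empty
    then show ?case by (intro eq_matI) (auto simp: module_mat_simps)
  next
    case (insert i I)
    then have "f \<in> I \<rightarrow> carrier (module_mat TYPE('a) r c)"
      "f i \<in> carrier (module_mat TYPE('a) r c)"
      by (auto simp: module_mat_simps)
    then have "(\<Oplus>\<^bsub>module_mat TYPE('a) r c\<^esub>i\<in>insert i I. f i) =
        f i + mat r c (\<lambda>(p, q). \<Sum>i\<in>I. f i $$ (p, q))"
      using insert by (simp add: module_mat_simps case_prod_unfold)
    also have "\<dots> = mat r c (\<lambda>(p, q). \<Sum>i\<in>insert i I. f i $$ (p, q))"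
      using insert by (intro eq_matI) auto
    finally show ?case .
  qed
qed

section \<open>Words over the index set and their products\<close>

definition words :: "nat \<Rightarrow> nat \<Rightarrow> nat list set" where
  "words d k = {is. length is = k \<and> set is \<subseteq> {1..d}}"

lemma finite_words: "finite (words d k)"
  using finite_lists_length_eq[of "{1..d}" k] by (simp add: words_def conj_commute)

lemma card_words: "card (words d k) = d ^ k"
  using card_lists_length_eq[of "{1..d}" k] by (simp add: words_def conj_commute)

lemma words_nonempty: "d \<ge> 1 \<Longrightarrow> words d k \<noteq> {}"
  using card_words[of d k] by auto

lemma words_append:
  assumes "is \<in> words d (j + k)"
  shows "take j is \<in> words d j" "drop j is \<in> words d k"
  using assms set_take_subset[of j "is"] set_drop_subset[of j "is"] by (auto simp: words_def)

lemma sum_words_Suc: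
  "(\<Sum>is\<in>words d (Suc k). f is) = (\<Sum>i\<in>{1..d}. \<Sum>is\<in>words d k. f (i # is))"
proof -
  have "words d (Suc k) = (\<lambda>(i, is). i # is) ` ({1..d} \<times> words d k)"
    by (auto simp: words_def image_iff length_Suc_conv)
  moreover have "inj_on (\<lambda>(i, is). i # is) ({1..d} \<times> words d k)"
    by (auto simp: inj_on_def)
  ultimately show ?thesis
    by (simp add: sum.reindex sum.cartesian_product comp_def case_prod_unfold)
qed

lemma word_prod_simps [simp]:
  "word_prod n X [] = 1\<^sub>m n" "word_prod n X (i # is) = X i * word_prod n X is"
  by (simp_all add: word_prod_def)

context
  fixes n d :: nat and X :: "nat \<Rightarrow> complex mat"
  assumes n: "n \<ge> 1" and d: "d \<ge> 1"
    and X: "\<And>i. i \<in> {1..d} \<Longrightarrow> X i \<in> carrier_mat n n"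
begin

lemma word_prod_carrier: "set is \<subseteq> {1..d} \<Longrightarrow> word_prod n X is \<in> carrier_mat n n"
proof (induction "is")
  case (Cons i "is")
  then have "X i \<in> carrier_mat n n" "word_prod n X is \<in> carrier_mat n n" by (auto intro: X)
  then show ?case by simp
qed simp

lemma word_prod_carrier_words: "is \<in> words d k \<Longrightarrow> word_prod n X is \<in> carrier_mat n n"
  by (rule word_prod_carrier) (simp add: words_def)

lemma word_prod_append:
  "set is \<subseteq> {1..d} \<Longrightarrow> set js \<subseteq> {1..d} \<Longrightarrow>
    word_prod n X (is @ js) = word_prod n X is * word_prod n X js"
  by (induction "is")
    (auto simp: word_prod_carrier X assoc_mult_mat[of _ n n _ n _ n] left_mult_one_mat[of _ n n])

section \<open>Powers of the outer matrix as sums over words\<close>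

abbreviation conj_square :: "complex mat \<Rightarrow> complex mat" where
  "conj_square A \<equiv> map_mat cnj A \<otimes>\<^sub>K A"

definition outer_mat :: "complex mat" where
  "outer_mat = (\<Oplus>\<^bsub>module_mat TYPE(complex) (n * n) (n * n)\<^esub>i\<in>{1..d}. conj_square (X i))"

lemma conj_square_carrier: "A \<in> carrier_mat n n \<Longrightarrow> conj_square A \<in> carrier_mat (n * n) (n * n)"
  by (intro kronecker_mat_carrier) auto

lemma outer_mat_eq:
  "outer_mat = mat (n * n) (n * n) (\<lambda>(p, q). \<Sum>i\<in>{1..d}. conj_square (X i) $$ (p, q))"
  unfolding outer_mat_def by (intro finsum_module_mat conj_square_carrier X) auto

lemma outer_mat_carrier: "outer_mat \<in> carrier_mat (n * n) (n * n)"
  by (simp add: outer_mat_eq)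

text \<open>Since \<open>conj_square\<close> is multiplicative, expanding the k-th power of the sum
  yields one term for each word of length k.\<close>

lemma outer_mat_power_index:
  assumes "p < n * n" "q < n * n"
  shows "(outer_mat ^\<^sub>m k) $$ (p, q) = (\<Sum>is\<in>words d k. conj_square (word_prod n X is) $$ (p, q))"
  using assms
proof (induction k arbitrary: p q)
  case 0
  \<comment> \<open>For k = 0 the only word is empty, and the Kronecker square of the identity is
    the identity because an index is determined by its quotient and remainder.\<close>
  have "p = q \<longleftrightarrow> p div n = q div n \<and> p mod n = q mod n"
    by (metis div_mult_mod_eq)
  moreover have "words d 0 = {[]}" by (auto simp: words_def)
  ultimately show ?case
    using 0 outer_mat_carrier by (auto simp: kronecker_mat_def div_less_of_mult mod_less_of_mult)
next
  case (Suc k)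
  have "(outer_mat ^\<^sub>m Suc k) $$ (p, q) =
      (\<Sum>c<n * n. outer_mat $$ (p, c) * (outer_mat ^\<^sub>m k) $$ (c, q))"
    using Suc.prems outer_mat_carrier pow_carrier_mat[OF outer_mat_carrier, of k]
    by (simp add: pow_mat_Suc_left[OF outer_mat_carrier] scalar_prod_def atLeast0LessThan
        del: pow_mat.simps)
  also have "\<dots> = (\<Sum>c<n * n. (\<Sum>i\<in>{1..d}. conj_square (X i) $$ (p, c))
      * (\<Sum>is\<in>words d k. conj_square (word_prod n X is) $$ (c, q)))"
    using Suc.prems by (intro sum.cong refl arg_cong2[where f = "(*)"] Suc.IH) (simp_all add: outer_mat_eq)
  \<comment> \<open>The sum over \<open>c\<close> moves innermost, where it is an entry of a product
    of two Kronecker squares.\<close>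
  also have "\<dots> = (\<Sum>i\<in>{1..d}. \<Sum>is\<in>words d k. \<Sum>c<n * n.
      conj_square (X i) $$ (p, c) * conj_square (word_prod n X is) $$ (c, q))"
    unfolding sum_product by (subst sum.swap, subst (2) sum.swap) simp
  also have "\<dots> = (\<Sum>i\<in>{1..d}. \<Sum>is\<in>words d k. conj_square (word_prod n X (i # is)) $$ (p, q))"
  proof (intro sum.cong refl)
    fix i "is" assume i: "i \<in> {1..d}" and w: "is \<in> words d k"
    note carr = X[OF i] word_prod_carrier_words[OF w]
    show "(\<Sum>c<n * n. conj_square (X i) $$ (p, c) * conj_square (word_prod n X is) $$ (c, q)) =
        conj_square (word_prod n X (i # is)) $$ (p, q)"
      using conj_square_carrier[OF carr(1)] conj_square_carrier[OF carr(2)] Suc.prems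
      by (simp add: map_mat_cnj_kronecker_mult[OF carr] scalar_prod_def atLeast0LessThan)
  qed
  also have "\<dots> = (\<Sum>is\<in>words d (Suc k). conj_square (word_prod n X is) $$ (p, q))"
    by (rule sum_words_Suc[symmetric])
  finally show ?case .
qed

section \<open>Largest norm of a word product and the joint spectral radius\<close>

definition max_norm :: "nat \<Rightarrow> real" where
  "max_norm k = Max ((\<lambda>is. op_norm_mat (word_prod n X is)) ` words d k)"

lemma max_norm_ge: "is \<in> words d k \<Longrightarrow> op_norm_mat (word_prod n X is) \<le> max_norm k"
  unfolding max_norm_def using finite_words by (intro Max_ge) auto

text \<open>There are finitely many words of length k, and at least one because d \<ge> 1.\<close>

lemma max_norm_attained: "\<exists>is\<in>words d k. max_norm k = op_norm_mat (word_prod n X is)"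
  unfolding max_norm_def using Max_in[of "(\<lambda>is. op_norm_mat (word_prod n X is)) ` words d k"]
    finite_words words_nonempty[OF d] by fastforce

lemma max_norm_nonneg: "0 \<le> max_norm k"
  using max_norm_attained[of k] op_norm_mat_nonneg by auto

text \<open>A word attaining the maximum for length j + k is cut after its first j letters.\<close>

lemma max_norm_submult: "max_norm (j + k) \<le> max_norm j * max_norm k"
proof -
  obtain "is" where w: "is \<in> words d (j + k)" "max_norm (j + k) = op_norm_mat (word_prod n X is)"
    using max_norm_attained by blast
  note parts = words_append[OF w(1)]
  have "word_prod n X (take j is @ drop j is) = word_prod n X (take j is) * word_prod n X (drop j is)"
    by (rule word_prod_append) (use parts in \<open>simp_all add: words_def\<close>)
  then have "max_norm (j + k) \<le>
      op_norm_mat (word_prod n X (take j is)) * op_norm_mat (word_prod n X (drop j is))"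
    using w parts by (simp add: op_norm_mat_mult_le[of _ n n _ n] word_prod_carrier_words)
  also have "\<dots> \<le> max_norm j * max_norm k"
    using parts by (intro mult_mono max_norm_ge max_norm_nonneg op_norm_mat_nonneg)
  finally show ?thesis .
qed

text \<open>Roots are monotone, so the supremum of the roots is the root of the maximum; Fekete's
  argument then shows that the \<open>lim\<close> in the definition is a genuine limit.\<close>

lemma joint_spectral_radius_limit:
  "(\<lambda>k. root k (max_norm k)) \<longlonglongrightarrow> joint_spectral_radius n d X"
proof -
  have "(SUP is\<in>{is. length is = k \<and> set is \<subseteq> {1..d}}. root k (op_norm_mat (word_prod n X is)))
      = root k (max_norm k)" for k
  proof -
    obtain js where js: "js \<in> words d k" "max_norm k = op_norm_mat (word_prod n X js)"
      using max_norm_attained by blast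
    have "root k (op_norm_mat (word_prod n X is)) \<le> root k (max_norm k)" if "is \<in> words d k" for "is"
      \<comment> \<open>For k = 0 both sides are 0, as \<open>root 0\<close> is constantly
        0.\<close>
      using max_norm_ge[OF that] by (cases "k = 0") auto
    then have "(SUP is\<in>words d k. root k (op_norm_mat (word_prod n X is))) = root k (max_norm k)"
      using js by (intro cSup_eq_maximum) auto
    then show ?thesis by (simp add: words_def)
  qed
  then show ?thesis
    unfolding joint_spectral_radius_def
    using submultiplicative_root_convergent[of max_norm, OF max_norm_nonneg max_norm_submult]
    by (simp add: convergent_LIMSEQ_iff)
qed

section \<open>Entries of the powers against norms of word products\<close>

lemma outer_mat_power_norm_bound:
  "norm_bound (outer_mat ^\<^sub>m k) (real d ^ k * (max_norm k)\<^sup>2)"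
proof (rule norm_boundI)
  fix p q assume "p < dim_row (outer_mat ^\<^sub>m k)" "q < dim_col (outer_mat ^\<^sub>m k)"
  then have pq: "p < n * n" "q < n * n"
    using pow_carrier_mat[OF outer_mat_carrier, of k] by auto
  have "cmod ((outer_mat ^\<^sub>m k) $$ (p, q)) \<le>
      (\<Sum>is\<in>words d k. cmod (conj_square (word_prod n X is) $$ (p, q)))"
    unfolding outer_mat_power_index[OF pq] by (rule norm_sum)
  \<comment> \<open>Up to conjugation, an entry of the Kronecker square is a product of two entries
    of the word product, each bounded by its operator norm.\<close>
  also have "\<dots> \<le> (\<Sum>is\<in>words d k. (max_norm k)\<^sup>2)"
  proof (rule sum_mono)
    fix "is" assume w: "is \<in> words d k"
    let ?A = "word_prod n X is"
    have A: "?A \<in> carrier_mat n n" by (rule word_prod_carrier_words[OF w])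
    have le: "cmod (?A $$ (a, b)) \<le> max_norm k" if "a < n" "b < n" for a b
      using norm_bound_op_norm_mat[of ?A] A that max_norm_ge[OF w]
      unfolding norm_bound_def by force
    have "cmod (conj_square ?A $$ (p, q)) =
        cmod (?A $$ (p div n, q div n)) * cmod (?A $$ (p mod n, q mod n))"
      using A pq by (simp add: kronecker_mat_def norm_mult div_less_of_mult)
    also have "\<dots> \<le> max_norm k * max_norm k"
      using pq by (intro mult_mono le max_norm_nonneg)
        (auto simp: div_less_of_mult mod_less_of_mult)
    finally show "cmod (conj_square ?A $$ (p, q)) \<le> (max_norm k)\<^sup>2"
      by (simp add: power2_eq_square)
  qed
  also have "\<dots> = real d ^ k * (max_norm k)\<^sup>2" by (simp add: card_words)
  finally show "cmod ((outer_mat ^\<^sub>m k) $$ (p, q)) \<le> real d ^ k * (max_norm k)\<^sup>2" .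
qed

(* The entry of conj_square A at (i n + i, j n + j) is |A (i, j)|^2, so these entries of the
   power are sums of nonnegative terms, one for each word. *)
lemma word_prod_norm_bound:
  assumes bound: "norm_bound (outer_mat ^\<^sub>m k) b" and w: "is \<in> words d k"
  shows "norm_bound (word_prod n X is) (sqrt b)"
proof (rule norm_boundI)
  fix i j assume "i < dim_row (word_prod n X is)" "j < dim_col (word_prod n X is)"
  then have ij: "i < n" "j < n" using word_prod_carrier_words[OF w] by auto
  define p q where "p = i * n + i" and "q = j * n + j"
  have lt: "a * n + a < n * n" if "a < n" for a
  proof -
    have "a * n + a < Suc a * n" using that by simp
    also have "\<dots> \<le> n * n" using that by (intro mult_le_mono1) simp
    finally show ?thesis .
  qed
  have pq: "p < n * n" "q < n * n" using ij lt by (simp_all add: p_def q_def)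
  have dm: "p div n = i" "p mod n = i" "q div n = j" "q mod n = j"
    using ij by (simp_all add: p_def q_def)
  have entry: "conj_square (word_prod n X js) $$ (p, q) =
      complex_of_real ((cmod (word_prod n X js $$ (i, j)))\<^sup>2)" if "js \<in> words d k" for js
  proof -
    have "conj_square (word_prod n X js) $$ (p, q) =
        cnj (word_prod n X js $$ (i, j)) * word_prod n X js $$ (i, j)"
      using word_prod_carrier_words[OF that] pq ij by (simp add: kronecker_mat_def dm)
    then show ?thesis by (simp only: complex_norm_square mult.commute)
  qed
  have "(cmod (word_prod n X is $$ (i, j)))\<^sup>2 \<le>
      (\<Sum>js\<in>words d k. (cmod (word_prod n X js $$ (i, j)))\<^sup>2)"
    using w finite_words by (intro member_le_sum) auto
  \<comment> \<open>The summands are nonnegative reals, so nothing cancels and the sum equals its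
    modulus.\<close>
  also have "\<dots> = cmod (\<Sum>js\<in>words d k. complex_of_real ((cmod (word_prod n X js $$ (i, j)))\<^sup>2))"
    by (simp only: of_real_sum[symmetric] norm_of_real) (simp add: sum_nonneg)
  also have "\<dots> = cmod ((outer_mat ^\<^sub>m k) $$ (p, q))"
    using entry by (simp add: outer_mat_power_index[OF pq])
  also have "\<dots> \<le> b"
    using bound pq carrier_matD[OF outer_mat_carrier] by (simp add: norm_bound_def)
  finally show "cmod (word_prod n X is $$ (i, j)) \<le> sqrt b" by (rule real_le_rsqrt)
qed

lemma max_norm_le:
  assumes bound: "norm_bound (outer_mat ^\<^sub>m k) b"
  shows "max_norm k \<le> real n * real n * sqrt b"
proof -
  obtain "is" where w: "is \<in> words d k" "max_norm k = op_norm_mat (word_prod n X is)"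
    using max_norm_attained by blast
  \<comment> \<open>As n \<ge> 1 the power has an entry, whose modulus lies below
    \<open>b\<close>.\<close>
  have "0 \<le> b"
    using norm_bound_nonneg[OF pow_carrier_mat[OF outer_mat_carrier] _ _ bound] n by simp
  then show ?thesis
    using op_norm_mat_le[OF word_prod_carrier_words[OF w(1)]] word_prod_norm_bound[OF bound w(1)] w
    by simp
qed

section \<open>The two inequalities\<close>

lemma outer_spectral_radius_eq: "outer_spectral_radius n d X = sqrt (spectral_radius outer_mat)"
  unfolding outer_spectral_radius_def outer_mat_def ..

lemma spectral_radius_outer_nonneg: "0 \<le> spectral_radius outer_mat"
  using spectral_radius_mem_max(1)[OF outer_mat_carrier] n by auto

text \<open>For each r above the spectral radius, the entries of the k-th power are at most
  \<open>C * r ^ k\<close>, hence \<open>max_norm k\<close> is at most a constant times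
  \<open>sqrt r ^ k\<close>, and roots give the bound \<open>sqrt r\<close>. Letting r decrease to
  the spectral radius finishes the proof.\<close>

lemma joint_spectral_radius_le_outer:
  "joint_spectral_radius n d X \<le> outer_spectral_radius n d X"
proof -
  let ?\<rho> = "spectral_radius outer_mat" and ?L = "joint_spectral_radius n d X"
  have le: "?L \<le> sqrt r" if r: "?\<rho> < r" for r
  proof -
    have r0: "r > 0" using r spectral_radius_outer_nonneg by simp
    then obtain C where C: "\<And>k. norm_bound (outer_mat ^\<^sub>m k) (C * r ^ k)"
      using pow_mat_norm_bound[OF outer_mat_carrier _ r] n by auto
    have "max_norm k \<le> (real n * real n * sqrt C) * sqrt r ^ k" for k
      using max_norm_le[OF C[of k]] by (simp add: real_sqrt_mult real_sqrt_power mult.assoc)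
    then show ?thesis using r0 by (intro root_limit_le[OF joint_spectral_radius_limit]) auto
  qed
  have "((\<lambda>r. sqrt r) \<longlongrightarrow> sqrt ?\<rho>) (at_right ?\<rho>)"
    by (intro tendsto_intros)
  moreover have "\<forall>\<^sub>F r in at_right ?\<rho>. ?L \<le> sqrt r"
    using le by (auto simp: eventually_at_filter)
  ultimately show ?thesis
    unfolding outer_spectral_radius_eq by (rule tendsto_lowerbound) simp
qed

text \<open>The eigenvalue estimate holds at the spectral radius itself, so no limit in r is taken.
  The factor \<open>real d ^ k\<close> counts the words; after the square root it becomes the loss
  of \<open>sqrt (real d)\<close>.\<close>

lemma outer_le_joint_spectral_radius:
  "outer_spectral_radius n d X / sqrt (real d) \<le> joint_spectral_radius n d X"
  unfolding outer_spectral_radius_eq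
proof (rule root_limit_ge[OF joint_spectral_radius_limit])
  fix k
  have "spectral_radius outer_mat ^ k \<le> real (n * n) * (real d ^ k * (max_norm k)\<^sup>2)"
    by (rule spectral_radius_power_le[OF outer_mat_carrier _ outer_mat_power_norm_bound]) (use n in simp)
  then have "sqrt (spectral_radius outer_mat ^ k) \<le> sqrt (real (n * n) * (real d ^ k * (max_norm k)\<^sup>2))"
    by (rule real_sqrt_le_mono)
  then have "sqrt (spectral_radius outer_mat) ^ k \<le> real n * (sqrt (real d) ^ k * max_norm k)"
    using max_norm_nonneg by (simp add: real_sqrt_mult real_sqrt_power)
  then show "(sqrt (spectral_radius outer_mat) / sqrt (real d)) ^ k \<le> real n * max_norm k"
    using d by (simp add: power_divide field_simps)
qed (use n spectral_radius_outer_nonneg in auto)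

end

theorem corollary1p5:
  fixes n d :: nat and X :: "nat \<Rightarrow> complex mat"
  assumes "n \<ge> 1" and "d \<ge> 1"
    and "\<And>i. i \<in> {1..d} \<Longrightarrow> X i \<in> carrier_mat n n"
  shows "1 / sqrt (real d) * outer_spectral_radius n d X \<le> joint_spectral_radius n d X
    \<and> joint_spectral_radius n d X \<le> outer_spectral_radius n d X"
  using outer_le_joint_spectral_radius[of n d X, OF assms]
    joint_spectral_radius_le_outer[of n d X, OF assms]
  by simp

end
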